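(* Let $m$ be a positive integer, let $a<t<b$, and let $$f(x)=\frac{g(x)}{(x-t)^m},\qquad g\in C^m(a,b),\quad g(x)\ \text{integrable at } x=a \text{ and } x=b.$$ Let the variable transformation $x=\psi(\xi)$ be such that $$\psi:[\alpha,\beta]\to[a,b],\quad \psi(\alpha)=a,\quad \psi(\beta)=b,\quad \psi\in C^m[\alpha,\beta],\quad \psi'(\xi)>0\ \text{ for } \alpha<\xi<\beta .$$ Then $$\mathrm{f.p.}\!\int_\alpha^\beta f(\psi(\xi))\,\psi'(\xi)\,d\xi=\mathrm{f.p.}\!\int_a^b f(x)\,dx,$$ independently of $\psi$.
   Context: All intervals are finite: $a<b$ and $\alpha<\beta$ are real numbers. "Integrable at $x=a$ and $x=b$" means that $g$ (equivalently $f$) is integrable on intervals $(a,a+\delta)$ and $(b-\delta,b)$ for small $\delta>0$; no continuity of $g$ at $a$ or $b$ is required. $\mathrm{f.p.}\!\int$ denotes the Hadamard Finite Part of an integral. If $u$ has a nonintegrable singularity at an interior point $t\in(a,b)$ but is integrable on every subinterval of $(a,b)$ whose closure does not contain $t$, then $\mathrm{f.p.}\!\int_a^b u(x)\,dx$ is obtained by expanding $$\phi(\epsilon)=\int_a^{t-\epsilon}u(x)\,dx+\int_{t+\epsilon}^b u(x)\,dx,\qquad \epsilon>0,$$ asymptotically as $\epsilon\to0+$, discarding the terms that go to infinity (here, multiples of negative powers of $\epsilon$ and of $\log\epsilon$), and taking the limit of the remaining terms as $\epsilon\to0+$. The integral $\mathrm{f.p.}\!\int_\alpha^\beta f(\psi(\xi))\psi'(\xi)\,d\xi$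 is understood in the same way, with the singular point $\tau\in(\alpha,\beta)$ being the unique solution of $\psi(\tau)=t$ (symmetric excision of $(\tau-\epsilon,\tau+\epsilon)$ in the variable $\xi$). *)

theory Defs
  imports "HOL-Analysis.Analysis" "HOL-Real_Asymp.Real_Asymp"
begin

text \<open>\<open>f\<close> is of class \<open>C\<^sup>k\<close> on \<open>S\<close>; \<open>D i\<close> is the \<open>i\<close>-th derivative. The derivatives are taken
  within \<open>S\<close>, hence they are one-sided at the endpoints of a closed interval.\<close>

definition Ck_on :: "nat \<Rightarrow> (real \<Rightarrow> real) \<Rightarrow> real set \<Rightarrow> bool" where
  "Ck_on k f S \<longleftrightarrow> (\<exists>D :: nat \<Rightarrow> real \<Rightarrow> real.
     (\<forall>x\<in>S. D 0 x = f x) \<and>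
     (\<forall>i<k. \<forall>x\<in>S. (D i has_real_derivative D (Suc i) x) (at x within S)) \<and>
     (\<forall>i\<le>k. continuous_on S (D i)))"

text \<open>Integrals are Henstock--Kurzweil integrals, which comprise Lebesgue integrals as well as
  improper Riemann integrals.\<close>

definition excised_integral :: "(real \<Rightarrow> real) \<Rightarrow> real \<Rightarrow> real \<Rightarrow> real \<Rightarrow> real \<Rightarrow> real" where
  "excised_integral u a b t \<epsilon> = integral {a..t - \<epsilon>} u + integral {t + \<epsilon>..b} u"

text \<open>The Hadamard finite part at an interior point \<open>t\<close>: as \<open>\<epsilon>\<close> tends to 0 from the right,
  the excised integral is a combination of negative powers of \<open>\<epsilon>\<close> and of \<open>ln \<epsilon>\<close>, plus \<open>I\<close>,
  plus \<open>o(1)\<close>.\<close>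

definition has_fp_integral ::
  "(real \<Rightarrow> real) \<Rightarrow> real \<Rightarrow> real \<Rightarrow> real \<Rightarrow> real \<Rightarrow> bool" where
  "has_fp_integral u a b t I \<longleftrightarrow>
     a < t \<and> t < b \<and>
     (\<forall>p q. {p..q} \<subseteq> {a..b} - {t} \<longrightarrow> u integrable_on {p..q}) \<and>
     (\<exists>(N::nat) (c :: nat \<Rightarrow> real) (d :: real).
        ((\<lambda>\<epsilon>. excised_integral u a b t \<epsilon> - ((\<Sum>k=1..N. c k / \<epsilon> ^ k) + d * ln \<epsilon>)) \<longlongrightarrow> I)
          (at_right 0))"

definition fp_integrable :: "(real \<Rightarrow> real) \<Rightarrow> real \<Rightarrow> real \<Rightarrow> real \<Rightarrow> bool" where
  "fp_integrable u a b t \<longleftrightarrow> (\<exists>I. has_fp_integral u a b t I)"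

definition fp_integral :: "(real \<Rightarrow> real) \<Rightarrow> real \<Rightarrow> real \<Rightarrow> real \<Rightarrow> real" where
  "fp_integral u a b t = (THE I. has_fp_integral u a b t I)"

lemma divergent_terms_limit_zero:
  fixes c :: "nat \<Rightarrow> real" and d L :: real
  assumes "((\<lambda>\<epsilon>. (\<Sum>k=1..N. c k / \<epsilon> ^ k) + d * ln \<epsilon>) \<longlongrightarrow> L) (at_right 0)"
  shows "L = 0"
  using assms
proof (induction N)
  case 0
  have inv: "((\<lambda>\<epsilon>::real. inverse (ln \<epsilon>)) \<longlongrightarrow> 0) (at_right 0)"
    by (rule tendsto_inverse_0[THEN filterlim_compose])
       (rule filterlim_mono[OF ln_at_0 at_bot_le_at_infinity order_refl])
  have "((\<lambda>\<epsilon>. d * ln \<epsilon> * inverse (ln \<epsilon>)) \<longlongrightarrow> L * 0) (at_right 0)"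
    using 0 inv by (intro tendsto_mult) simp_all
  moreover have "\<forall>\<^sub>F \<epsilon> in at_right 0. d * ln \<epsilon> * inverse (ln \<epsilon>) = d"
    using eventually_at_right_real[of 0 "1::real", OF zero_less_one]
  proof eventually_elim
    case (elim \<epsilon>)
    then have "ln \<epsilon> \<noteq> 0"
      by simp
    then show ?case
      by simp
  qed
  ultimately have "((\<lambda>\<epsilon>::real. d) \<longlongrightarrow> 0) (at_right 0)"
    by (simp add: tendsto_cong)
  then have "d = 0"
    by (simp add: tendsto_const_iff)
  with 0 show ?case
    by (simp add: tendsto_const_iff)
next
  case (Suc N)
  let ?E = "\<lambda>\<epsilon>. (\<Sum>k=1..N. c k * \<epsilon> ^ (Suc N - k)) + c (Suc N) + d * (\<epsilon> ^ N * (\<epsilon> * ln \<epsilon>))"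
  have id: "((\<lambda>\<epsilon>::real. \<epsilon>) \<longlongrightarrow> 0) (at_right 0)"
    by simp
  have pow: "((\<lambda>\<epsilon>::real. \<epsilon> ^ j) \<longlongrightarrow> 0) (at_right 0)" if "j > 0" for j
    using tendsto_power[OF id, of j] that by (simp add: zero_power)
  have powN: "((\<lambda>\<epsilon>::real. \<epsilon> ^ N) \<longlongrightarrow> 0 ^ N) (at_right 0)"
    using tendsto_power[OF id] .
  have xln: "((\<lambda>\<epsilon>::real. \<epsilon> * ln \<epsilon>) \<longlongrightarrow> 0) (at_right 0)"
    by real_asymp
  have "((\<lambda>\<epsilon>. \<epsilon> ^ Suc N * ((\<Sum>k=1..Suc N. c k / \<epsilon> ^ k) + d * ln \<epsilon>)) \<longlongrightarrow> 0 * L) (at_right 0)"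
    by (intro tendsto_mult Suc.prems pow) simp
  moreover have "\<forall>\<^sub>F \<epsilon> in at_right 0.
      \<epsilon> ^ Suc N * ((\<Sum>k=1..Suc N. c k / \<epsilon> ^ k) + d * ln \<epsilon>) = ?E \<epsilon>"
    using eventually_at_right_less[of "0::real"]
    by eventually_elim
       (auto simp: algebra_simps sum_distrib_left power_diff intro!: sum.cong)
  ultimately have "(?E \<longlongrightarrow> 0) (at_right 0)"
    by (simp add: tendsto_cong)
  moreover have "(?E \<longlongrightarrow> (\<Sum>k=1..N. c k * 0) + c (Suc N) + d * (0 ^ N * 0)) (at_right 0)"
    by (intro tendsto_intros pow powN xln) auto
  ultimately have "c (Suc N) = 0"
    using tendsto_unique[OF trivial_limit_at_right_real] by fastforce
  with Suc.prems show ?case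
    by (intro Suc.IH) simp
qed

lemma has_fp_integral_unique:
  assumes "has_fp_integral u a b t I" "has_fp_integral u a b t J"
  shows "I = J"
proof -
  let ?S = "\<lambda>N c d \<epsilon>::real. (\<Sum>k=1..N::nat. c k / \<epsilon> ^ k) + d * ln \<epsilon> :: real"
  obtain N c d where 1: "((\<lambda>\<epsilon>. excised_integral u a b t \<epsilon> - ?S N c d \<epsilon>) \<longlongrightarrow> I) (at_right 0)"
    using assms(1) unfolding has_fp_integral_def by blast
  obtain N' c' d' where 2: "((\<lambda>\<epsilon>. excised_integral u a b t \<epsilon> - ?S N' c' d' \<epsilon>) \<longlongrightarrow> J) (at_right 0)"
    using assms(2) unfolding has_fp_integral_def by blast
  define M where "M = max N N'"
  define e where "e k = (if k \<le> N' then c' k else 0) - (if k \<le> N then c k else 0)" for k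
  have extend: "(\<Sum>k=1..K. h k / \<epsilon> ^ k) = (\<Sum>k=1..M. (if k \<le> K then h k else 0) / \<epsilon> ^ k)"
    if "K \<le> M" for K h and \<epsilon> :: real
    using that by (intro sum.mono_neutral_cong_left) auto
  have "?S M e (d' - d) \<epsilon> = ?S N' c' d' \<epsilon> - ?S N c d \<epsilon>" for \<epsilon>
    using extend[of N c \<epsilon>] extend[of N' c' \<epsilon>]
    by (simp add: M_def e_def diff_divide_distrib sum_subtractf algebra_simps)
  then have "?S M e (d' - d) = (\<lambda>\<epsilon>. (excised_integral u a b t \<epsilon> - ?S N c d \<epsilon>)
      - (excised_integral u a b t \<epsilon> - ?S N' c' d' \<epsilon>))"
    by (intro ext) (simp del: One_nat_def)
  then have "(?S M e (d' - d) \<longlongrightarrow> I - J) (at_right 0)"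
    using tendsto_diff[OF 1 2] by metis
  then show ?thesis
    using divergent_terms_limit_zero by fastforce
qed

lemma fp_integral_eqI: "has_fp_integral u a b t I \<Longrightarrow> fp_integral u a b t = I"
  unfolding fp_integral_def by (blast intro: has_fp_integral_unique)

end

theory Submission
  imports Defs
begin

text \<open>Write \<open>m = n + 1\<close>. Taylor's formula at \<open>t\<close> gives \<open>f\<close> the antiderivative
  \<open>G(x) = (\<Sum>k<n. C\<^sub>k / (x - t)\<^bsup>n - k\<^esup>) + c ln (x - t)\<^sup>2 + H(x)\<close> on both sides of \<open>t\<close>, with \<open>H\<close> continuous
  on the closed interval. The excised integral of \<open>(f \<circ> \<psi>) \<psi>'\<close> is therefore
  \<open>G(b) - G(a) + G(\<psi>(\<tau> - \<epsilon>)) - G(\<psi>(\<tau> + \<epsilon>))\<close>. Each term of \<open>G(\<psi>(\<tau> + s))\<close> is a Laurent polynomial in \<open>s\<close>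
  plus \<open>o(1)\<close>, or \<open>ln s\<^sup>2\<close> plus a term with a limit; in the difference of the values at \<open>-\<epsilon>\<close> and
  \<open>\<epsilon>\<close> the constant terms and the logarithms cancel. So the finite part is \<open>G(b) - G(a)\<close> for every \<open>\<psi>\<close>, in
  particular for the identity. Only \<open>\<psi> \<in> C\<^sup>m\<close> is needed since the pole of \<open>G\<close> has order at most \<open>m - 1\<close>.\<close>

section \<open>Finite Taylor-type expansions at 0 and their algebra\<close>

text \<open>\<open>expands n u\<close>: \<open>u(s)\<close> is a polynomial plus \<open>o(s\<^sup>n)\<close> as \<open>s \<rightarrow> 0\<close>, \<open>s \<noteq> 0\<close>; the recursive
  form makes closure under products and inverses a plain induction.\<close>

fun expands :: "nat \<Rightarrow> (real \<Rightarrow> real) \<Rightarrow> bool" where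
  "expands 0 u \<longleftrightarrow> (\<exists>L. (u \<longlongrightarrow> L) (at 0))"
| "expands (Suc n) u \<longleftrightarrow> (\<exists>c v. expands n v \<and> (\<forall>\<^sub>F s in at 0. u s = c + s * v s))"

lemma expands_cong:
  assumes "\<forall>\<^sub>F s in at 0. u s = v s" "expands n v"
  shows "expands n u"
proof (cases n)
  case 0
  then show ?thesis using assms by (auto simp: tendsto_cong)
next
  case (Suc k)
  then obtain c w where "expands k w" "\<forall>\<^sub>F s in at 0. v s = c + s * w s"
    using assms(2) by auto
  moreover from this(2) assms(1) have "\<forall>\<^sub>F s in at 0. u s = c + s * w s"
    by eventually_elim simp
  ultimately show ?thesis using Suc by auto
qed

lemma expands_SucD: "expands (Suc n) u \<Longrightarrow> expands n u"
proof (induction n arbitrary: u)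
  case 0
  then obtain c v L where v: "(v \<longlongrightarrow> L) (at 0)" and u: "\<forall>\<^sub>F s in at 0. u s = c + s * v s"
    by auto
  have "((\<lambda>s. c + s * v s) \<longlongrightarrow> c + 0 * L) (at 0)"
    by (intro tendsto_intros v)
  then show ?case using u by (auto simp: tendsto_cong)
next
  case (Suc n)
  then show ?case by (metis expands.simps(2))
qed

lemma expands_tendsto: "expands n u \<Longrightarrow> \<exists>L. (u \<longlongrightarrow> L) (at 0)"
  by (induction n) (auto dest: expands_SucD simp del: expands.simps(2))

lemma expands_const: "expands n (\<lambda>_. c)"
proof (induction n arbitrary: c)
  case 0
  show ?case by auto
next
  case (Suc n)
  have "\<forall>\<^sub>F s in at 0. c = c + s * (0::real)" by simp
  then show ?case using Suc[of 0] by (auto intro!: exI[of _ c] exI[of _ "\<lambda>_. 0"])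
qed

lemma expands_add: "expands n u \<Longrightarrow> expands n v \<Longrightarrow> expands n (\<lambda>s. u s + v s)"
proof (induction n arbitrary: u v)
  case 0
  then show ?case by (auto intro: tendsto_add)
next
  case (Suc n)
  obtain c u1 where u: "expands n u1" "\<forall>\<^sub>F s in at 0. u s = c + s * u1 s"
    using Suc.prems by auto
  obtain d v1 where v: "expands n v1" "\<forall>\<^sub>F s in at 0. v s = d + s * v1 s"
    using Suc.prems by auto
  have "\<forall>\<^sub>F s in at 0. u s + v s = (c + d) + s * (u1 s + v1 s)"
    using u(2) v(2) by eventually_elim (simp add: algebra_simps)
  then show ?case using Suc.IH[OF u(1) v(1)] unfolding expands.simps by blast
qed

text \<open>Multiplication by \<open>s\<close> raises the order, so at order \<open>Suc k\<close>
  the function \<open>u\<close> itself serves as the tail, with constant term 0; only its expansion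
  to order \<open>k\<close> is then used.\<close>

lemma expands_times_id: "expands n u \<Longrightarrow> expands n (\<lambda>s. s * u s)"
proof (cases n)
  case 0
  assume "expands n u"
  then obtain L where "(u \<longlongrightarrow> L) (at 0)" using 0 by auto
  then have "((\<lambda>s. s * u s) \<longlongrightarrow> 0 * L) (at 0)"
    by (intro tendsto_intros)
  then show ?thesis using 0 by auto
next
  case (Suc k)
  assume "expands n u"
  then have "expands k u" using Suc expands_SucD by blast
  then show ?thesis using Suc by (auto intro!: exI[of _ 0] exI[of _ u])
qed

lemma expands_mult: "expands n u \<Longrightarrow> expands n v \<Longrightarrow> expands n (\<lambda>s. u s * v s)"
proof (induction n arbitrary: u v)
  case 0
  then show ?case by (auto intro: tendsto_mult)
next
  case (Suc n)
  obtain c u1 where u: "expands n u1" "\<forall>\<^sub>F s in at 0. u s = c + s * u1 s"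
    using Suc.prems by auto
  obtain d v1 where v: "expands n v1" "\<forall>\<^sub>F s in at 0. v s = d + s * v1 s"
    using Suc.prems by auto
  \<comment> \<open>The surplus factor \<open>s\<close> stays inside the tail in front of
    \<open>u1 s * v1 s\<close>, so that every summand of the tail has order \<open>n\<close> and the
    induction hypothesis covers all products.\<close>
  have "\<forall>\<^sub>F s in at 0. u s * v s = c * d + s * (c * v1 s + (d * u1 s + s * (u1 s * v1 s)))"
    using u(2) v(2) by eventually_elim (simp add: algebra_simps)
  moreover have "expands n (\<lambda>s. c * v1 s + (d * u1 s + s * (u1 s * v1 s)))"
    by (intro expands_add expands_times_id Suc.IH expands_const u v)
  ultimately show ?case unfolding expands.simps by blast
qed

lemma expands_power: "expands n u \<Longrightarrow> expands n (\<lambda>s. u s ^ k)"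
  by (induction k) (auto intro: expands_const expands_mult)

lemma expands_sum: "(\<And>i. i \<in> A \<Longrightarrow> expands n (u i)) \<Longrightarrow> expands n (\<lambda>s. \<Sum>i\<in>A. u i s)"
  by (induction A rule: infinite_finite_induct) (auto intro: expands_const expands_add)

lemma expands_id: "expands n (\<lambda>s. s)"
  using expands_times_id[OF expands_const[of n 1]] by simp

text \<open>If u = c + s v, then 1/u = 1/c - s v/(c u). The tail again contains 1/u, but only to one
  order less, which the induction hypothesis supplies.\<close>

lemma expands_inverse:
  assumes "expands n u" "(u \<longlongrightarrow> L) (at 0)" "L \<noteq> 0"
  shows "expands n (\<lambda>s. inverse (u s))"
  using assms
proof (induction n)
  case 0
  then show ?case by (auto intro: tendsto_inverse)
next
  case (Suc n)
  obtain c v where v: "expands n v" "\<forall>\<^sub>F s in at 0. u s = c + s * v s"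
    using Suc.prems by auto
  obtain M where M: "(v \<longlongrightarrow> M) (at 0)"
    using expands_tendsto[OF v(1)] by blast
  have "((\<lambda>s. c + s * v s) \<longlongrightarrow> c + 0 * M) (at 0)"
    by (intro tendsto_intros M)
  then have "(u \<longlongrightarrow> c) (at 0)" using v(2) by (simp add: tendsto_cong)
  \<comment> \<open>The constant term is the limit of \<open>u\<close>, hence equal to
    \<open>L\<close>.\<close>
  then have c: "c \<noteq> 0" using Suc.prems tendsto_unique by (metis at_neq_bot)
  have IH: "expands n (\<lambda>s. inverse (u s))"
    using Suc expands_SucD by blast
  have "\<forall>\<^sub>F s in at 0. u s \<noteq> 0"
    using Suc.prems by (intro tendsto_imp_eventually_ne)
  with v(2) have "\<forall>\<^sub>F s in at 0. inverse (u s) = inverse c + s * (- inverse c * (v s * inverse (u s)))"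
  proof eventually_elim
    case (elim s)
    have "inverse c * inverse (u s) * (u s - s * v s) = inverse (u s)"
      using elim c by simp
    moreover have "inverse c * inverse (u s) * (u s - s * v s) = inverse c * (inverse (u s) * u s)
        + s * (- inverse c * (v s * inverse (u s)))"
      by (simp add: algebra_simps)
    moreover have "inverse (u s) * u s = 1" using elim by simp
    ultimately show ?case by (metis mult.right_neutral)
  qed
  moreover have "expands n (\<lambda>s. - inverse c * (v s * inverse (u s)))"
    by (intro expands_mult expands_const v IH)
  ultimately show ?case unfolding expands.simps by blast
qed

text \<open>Turns a Taylor formula into the recursive form: the coefficient \<open>c 0\<close> is
  split off and the remaining coefficients are shifted by one.\<close>

lemma expands_polynomial_remainder:
  assumes "(v \<longlongrightarrow> L) (at 0)"
  shows "expands n (\<lambda>s. (\<Sum>k<n. c k * s ^ k) + s ^ n * v s)"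
proof (induction n arbitrary: c)
  case 0
  then show ?case using assms by auto
next
  case (Suc n)
  have "(\<Sum>k<Suc n. c k * s ^ k) + s ^ Suc n * v s
      = c 0 + s * ((\<Sum>k<n. c (Suc k) * s ^ k) + s ^ n * v s)" for s
    by (simp add: sum.lessThan_Suc_shift sum_distrib_left algebra_simps del: sum.lessThan_Suc)
  then show ?case using Suc[of "\<lambda>k. c (Suc k)"] unfolding expands.simps
    by (intro exI[of _ "c 0"] exI[of _ "\<lambda>s. (\<Sum>k<n. c (Suc k) * s ^ k) + s ^ n * v s"]) simp
qed

section \<open>Comparing values at opposite points near 0\<close>

lemma filterlim_uminus_at_0: "filterlim (\<lambda>\<epsilon>::real. - \<epsilon>) (at 0) (at_right 0)"
  by (rule filterlim_atI)
     (auto intro!: tendsto_eq_intros eventually_mono[OF eventually_at_right_less])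

lemma eventually_at_0_symmetric:
  fixes P :: "real \<Rightarrow> bool"
  assumes "eventually P (at 0)"
  shows "\<forall>\<^sub>F \<epsilon> in at_right 0. P \<epsilon> \<and> P (- \<epsilon>)"
proof (rule eventually_conj)
  show "eventually P (at_right 0)"
    using assms by (rule filter_leD[OF at_le, rotated]) simp
  show "\<forall>\<^sub>F \<epsilon> in at_right 0. P (- \<epsilon>)"
    using filterlim_uminus_at_0 assms unfolding filterlim_iff by blast
qed

lemma tendsto_odd_part:
  fixes u :: "real \<Rightarrow> real"
  assumes "(u \<longlongrightarrow> L) (at 0)"
  shows "((\<lambda>\<epsilon>. u (- \<epsilon>) - u \<epsilon>) \<longlongrightarrow> 0) (at_right 0)"
proof -
  have "((\<lambda>\<epsilon>. u (- \<epsilon>) - u \<epsilon>) \<longlongrightarrow> L - L) (at_right 0)"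
    by (intro tendsto_diff filterlim_compose[OF assms filterlim_uminus_at_0]
        tendsto_mono[OF _ assms] at_le) auto
  then show ?thesis by simp
qed

text \<open>The constant term of a Laurent expansion is even in the variable, so it cancels here.\<close>

lemma expands_odd_part:
  assumes "expands n u"
  shows "\<exists>c. ((\<lambda>\<epsilon>. u (- \<epsilon>) / (- \<epsilon>) ^ n - u \<epsilon> / \<epsilon> ^ n - (\<Sum>k=1..n. c k / \<epsilon> ^ k)) \<longlongrightarrow> 0)
    (at_right 0)"
  using assms
proof (induction n arbitrary: u)
  case 0
  then obtain L where "(u \<longlongrightarrow> L) (at 0)" by auto
  from tendsto_odd_part[OF this] show ?case by simp
next
  case (Suc n)
  obtain c v where v: "expands n v" and u: "\<forall>\<^sub>F s in at 0. u s = c + s * v s"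
    using Suc.prems by auto
  obtain d where d: "((\<lambda>\<epsilon>. v (- \<epsilon>) / (- \<epsilon>) ^ n - v \<epsilon> / \<epsilon> ^ n - (\<Sum>k=1..n. d k / \<epsilon> ^ k)) \<longlongrightarrow> 0)
    (at_right 0)" using Suc.IH[OF v] by blast
  \<comment> \<open>The pole c/s^(n+1) taken at -\<epsilon> minus at \<epsilon> leaves one new
    coefficient: 0 if n + 1 is even, -2c if it is odd. The lower coefficients are those of the tail
    \<open>v\<close>.\<close>
  define e where "e = d(Suc n := c / (-1) ^ Suc n - c)"
  have "\<forall>\<^sub>F \<epsilon> in at_right 0. u (- \<epsilon>) / (- \<epsilon>) ^ Suc n - u \<epsilon> / \<epsilon> ^ Suc n - (\<Sum>k=1..Suc n. e k / \<epsilon> ^ k)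
      = v (- \<epsilon>) / (- \<epsilon>) ^ n - v \<epsilon> / \<epsilon> ^ n - (\<Sum>k=1..n. d k / \<epsilon> ^ k)"
    using eventually_at_0_symmetric[OF u] eventually_at_right_less[of "0::real"]
  proof eventually_elim
    case (elim \<epsilon>)
    have "(\<Sum>k=1..n. e k / \<epsilon> ^ k) = (\<Sum>k=1..n. d k / \<epsilon> ^ k)"
      by (intro sum.cong) (auto simp: e_def)
    moreover have "u (- \<epsilon>) / (- \<epsilon>) ^ Suc n = c / (-1) ^ Suc n / \<epsilon> ^ Suc n + v (- \<epsilon>) / (- \<epsilon>) ^ n"
      using elim by (simp add: add_divide_distrib power_minus[of \<epsilon> n] field_simps)
    moreover have "u \<epsilon> / \<epsilon> ^ Suc n = c / \<epsilon> ^ Suc n + v \<epsilon> / \<epsilon> ^ n"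
      using elim by (simp add: add_divide_distrib)
    ultimately show ?case by (simp add: e_def diff_divide_distrib)
  qed
  from tendsto_cong[OF this] d show ?case by blast
qed

section \<open>Taylor's formula with a continuous remainder quotient\<close>

lemma Ck_on_subset: "Ck_on k f S \<Longrightarrow> T \<subseteq> S \<Longrightarrow> Ck_on k f T"
proof -
  assume T: "T \<subseteq> S" and "Ck_on k f S"
  then obtain D where "\<forall>x\<in>S. D 0 x = f x"
    "\<forall>i<k. \<forall>x\<in>S. (D i has_real_derivative D (Suc i) x) (at x within S)"
    "\<forall>i\<le>k. continuous_on S (D i)"
    unfolding Ck_on_def by blast
  then show ?thesis unfolding Ck_on_def using T
    by (intro exI[of _ D]) (blast intro: DERIV_subset[OF _ T] continuous_on_subset[OF _ T])
qed

lemma Ck_on_continuous: "Ck_on k f S \<Longrightarrow> continuous_on S f"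
  unfolding Ck_on_def by (metis continuous_on_cong zero_le)

text \<open>By the Lagrange form, the quotient \<open>R x\<close> is \<open>D m y / fact m\<close>
  for some \<open>y\<close> at most as far from \<open>t\<close> as \<open>x\<close>. As
  \<open>x\<close> tends to \<open>t\<close>, so does \<open>y\<close>, and continuity of
  \<open>D m\<close> extends \<open>R\<close> continuously to \<open>t\<close>. Continuity on the
  whole interval is what later makes \<open>R\<close> an integrand.\<close>

lemma Taylor_Peano:
  assumes "Ck_on m g {a<..<b}" and t: "t \<in> {a<..<b}" and m: "m > 0"
  obtains c :: "nat \<Rightarrow> real" and R where "continuous_on {a<..<b} R"
    "\<And>x. x \<in> {a<..<b} \<Longrightarrow> g x = (\<Sum>k<m. c k * (x - t) ^ k) + (x - t) ^ m * R x"
proof -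
  obtain D where D0: "\<And>x. x \<in> {a<..<b} \<Longrightarrow> D 0 x = g x"
    and D': "\<And>i x. i < m \<Longrightarrow> x \<in> {a<..<b} \<Longrightarrow>
      (D i has_real_derivative D (Suc i) x) (at x within {a<..<b})"
    and cD: "\<And>i. i \<le> m \<Longrightarrow> continuous_on {a<..<b} (D i)"
    using assms(1) unfolding Ck_on_def by metis
  have D: "(D i has_real_derivative D (Suc i) x) (at x)" if "i < m" "x \<in> {a<..<b}" for i x
    using D'[OF that] at_within_open[OF that(2) open_greaterThanLessThan] by simp
  define c where "c k = D k t / fact k" for k
  define P where "P x = (\<Sum>k<m. c k * (x - t) ^ k)" for x
  define R where "R x = (if x = t then D m t / fact m else (g x - P x) / (x - t) ^ m)" for x
  have "\<exists>y. \<bar>y - t\<bar> \<le> \<bar>x - t\<bar> \<and> y \<in> {a<..<b} \<and> R x = D m y / fact m" if x: "x \<in> {a<..<b}" for x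
  proof (cases "x = t")
    case True
    then show ?thesis using t by (auto simp: R_def)
  next
    case False
    have "\<exists>y. (if x < t then x < y \<and> y < t else t < y \<and> y < x) \<and>
      D 0 x = (\<Sum>k<m. (D k t / fact k) * (x - t)^k) + (D m y / fact m) * (x - t)^m"
    \<comment> \<open>The closed interval spanned by \<open>x\<close> and \<open>t\<close> stays
      inside the open interval, so the derivatives required there are two-sided.\<close>
    proof (intro Taylor[of _ _ _ "min x t" "max x t"] allI impI)
      fix k y assume "k < m \<and> min x t \<le> y \<and> y \<le> max x t"
      then show "(D k has_real_derivative D (Suc k) y) (at y)"
        using x t by (intro D) (auto simp: min_def max_def split: if_splits)
    qed (use m False in auto)
    then obtain y where y: "(if x < t then x < y \<and> y < t else t < y \<and> y < x)"
      and "D 0 x = P x + (D m y / fact m) * (x - t)^m"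
      by (auto simp: P_def c_def)
    then have "R x = D m y / fact m" using False D0[OF x] by (simp add: R_def)
    then show ?thesis using y x t by (intro exI[of _ y]) (auto split: if_splits)
  qed
  then obtain y where y: "\<And>x. x \<in> {a<..<b} \<Longrightarrow> \<bar>y x - t\<bar> \<le> \<bar>x - t\<bar>"
    "\<And>x. x \<in> {a<..<b} \<Longrightarrow> R x = D m (y x) / fact m" by metis
  have ev: "\<forall>\<^sub>F x in at t. x \<in> {a<..<b}"
    using t by (intro eventually_at_in_open') auto
  have "((\<lambda>x. \<bar>x - t\<bar>) \<longlongrightarrow> \<bar>t - t\<bar>) (at t)" by (intro tendsto_intros)
  then have lim: "((\<lambda>x. \<bar>x - t\<bar>) \<longlongrightarrow> 0) (at t)" by simp
  have "\<forall>\<^sub>F x in at t. norm (y x - t) \<le> \<bar>x - t\<bar>"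
    using ev by eventually_elim (simp only: real_norm_def y(1))
  from Lim_null_comparison[OF this lim] have "((\<lambda>x. y x - t) \<longlongrightarrow> 0) (at t)" .
  then have yt: "(y \<longlongrightarrow> t) (at t)" by (simp add: LIM_zero_iff)
  have "isCont (D m) t" using cD[of m] t by (simp add: continuous_on_eq_continuous_at)
  from isCont_tendsto_compose[OF this yt]
  have "((\<lambda>x. D m (y x) / fact m) \<longlongrightarrow> D m t / fact m) (at t)"
    by (intro tendsto_divide tendsto_const) simp_all
  moreover have "\<forall>\<^sub>F x in at t. R x = D m (y x) / fact m"
    using ev by eventually_elim (rule y(2))
  ultimately have "(R \<longlongrightarrow> R t) (at t)"
    by (simp add: tendsto_cong R_def)
  then have Rt: "isCont R t" by (simp add: isCont_def)
  have "continuous_on ({a<..<b} - {t}) (\<lambda>x. (D 0 x - P x) / (x - t) ^ m)"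
    unfolding P_def by (intro continuous_intros continuous_on_subset[OF cD]) auto
  then have "continuous_on ({a<..<b} - {t}) R"
    by (rule continuous_on_eq) (auto simp: R_def D0)
  then have "isCont R x" if "x \<in> {a<..<b} - {t}" for x
    using that by (subst (asm) continuous_on_eq_continuous_at) (auto intro: open_delete)
  with Rt have "continuous_on {a<..<b} R"
    by (metis Diff_iff continuous_at_imp_continuous_on singletonD)
  moreover have "g x = (\<Sum>k<m. c k * (x - t) ^ k) + (x - t) ^ m * R x" if "x \<in> {a<..<b}" for x
  proof (cases "x = t")
    case True
    \<comment> \<open>At \<open>x = t\<close> only the term \<open>k = 0\<close> survives; it is
      present because \<open>m\<close> is positive.\<close>
    obtain n where n: "m = Suc n" using m by (cases m) auto
    show ?thesis unfolding True n
      by (simp add: sum.lessThan_Suc_shift c_def D0[OF t] del: sum.lessThan_Suc)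
  next
    case False
    then show ?thesis by (simp add: R_def P_def)
  qed
  ultimately show ?thesis by (rule that)
qed

section \<open>An antiderivative of the singular integrand\<close>

lemma integral_has_real_derivative_isCont:
  fixes g :: "real \<Rightarrow> real"
  assumes "g integrable_on {a..b}" "x \<in> {a<..<b}" "isCont g x"
  shows "((\<lambda>x. integral {a..x} g) has_real_derivative g x) (at x)"
proof -
  have "x \<in> {a..b} - {}" using assms(2) by auto
  from integral_has_vector_derivative_continuous_at[OF assms(1) this finite.emptyI]
  have "((\<lambda>x. integral {a..x} g) has_vector_derivative g x) (at x within {a..b})"
    using continuous_at_imp_continuous_at_within[OF assms(3), of "{a..b}"] by simp
  then show ?thesis using assms(2)
    by (simp add: at_within_Icc_at has_real_derivative_iff_has_vector_derivative)
qed

text \<open>By parts, since \<open>g\<close> need not be absolutely integrable.\<close>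

lemma integrable_on_mult_C1:
  fixes g w :: "real \<Rightarrow> real"
  assumes g: "g integrable_on {a..b}" and "a \<le> b" and gc: "continuous_on {a<..<b} g"
    and w: "\<And>x. x \<in> {a..b} \<Longrightarrow> (w has_real_derivative w' x) (at x)" and w': "continuous_on {a..b} w'"
  shows "(\<lambda>x. g x * w x) integrable_on {a..b}"
proof -
  define G where "G x = integral {a..x} g" for x
  have G: "continuous_on {a..b} G"
    unfolding G_def by (rule indefinite_integral_continuous_1[OF g])
  have dG: "(G has_real_derivative g x) (at x)" if "x \<in> {a<..<b}" for x
    unfolding G_def using gc that
    by (intro integral_has_real_derivative_isCont[OF g]) (simp_all add: continuous_on_eq_continuous_at)
  have cw: "continuous_on {a..b} w"
    using w by (meson DERIV_isCont continuous_at_imp_continuous_on)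
  \<comment> \<open>This is the derivative of \<open>G x * w x\<close> inside the interval. Its
    second summand is continuous, so subtracting it leaves an integrable function.\<close>
  have "((\<lambda>x. g x * w x + w' x * G x) has_integral (G b * w b - G a * w a)) {a..b}"
  proof (rule fundamental_theorem_of_calculus_interior[OF \<open>a \<le> b\<close>])
    show "continuous_on {a..b} (\<lambda>x. G x * w x)" by (intro continuous_intros G cw)
    show "((\<lambda>x. G x * w x) has_vector_derivative g x * w x + w' x * G x) (at x)"
      if "x \<in> {a<..<b}" for x
      unfolding has_real_derivative_iff_has_vector_derivative[symmetric]
      using that by (intro DERIV_mult dG w) auto
  qed
  moreover have "(\<lambda>x. w' x * G x) integrable_on {a..b}"
    by (intro integrable_continuous_interval continuous_intros G w')
  ultimately have "(\<lambda>x. (g x * w x + w' x * G x) - w' x * G x) integrable_on {a..b}"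
    by (intro integrable_diff) auto
  then show ?thesis by simp
qed

text \<open>Dividing the Taylor formula of \<open>g\<close> by (x - t)^(n+1) splits \<open>f\<close>
  into powers with exponent at most -2, a multiple of 1/(x - t), and the remainder \<open>R\<close>.
  The first two have explicit antiderivatives, and \<open>R\<close> is integrable up to
  \<open>a\<close> and \<open>b\<close>, so its indefinite integral \<open>H\<close> is continuous
  on the closed interval.\<close>

lemma fp_antiderivative:
  fixes f g :: "real \<Rightarrow> real"
  assumes at: "a < t" and tb: "t < b"
    and f: "\<And>x. x \<in> {a<..<b} - {t} \<Longrightarrow> f x = g x / (x - t) ^ Suc n"
    and g: "Ck_on (Suc n) g {a<..<b}"
    and ga: "\<forall>\<^sub>F \<delta> in at_right 0. g integrable_on {a<..<a + \<delta>}"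
    and gb: "\<forall>\<^sub>F \<delta> in at_right 0. g integrable_on {b - \<delta><..<b}"
  shows "\<exists>(C :: nat \<Rightarrow> real) c H. continuous_on {a..b} H \<and> (\<forall>x\<in>{a<..<b} - {t}.
    ((\<lambda>x. (\<Sum>k<n. C k / (x - t) ^ (n - k)) + c * ln ((x - t)\<^sup>2) + H x) has_real_derivative f x) (at x))"
proof -
  obtain d R where cR: "continuous_on {a<..<b} R"
    and gR: "\<And>x. x \<in> {a<..<b} \<Longrightarrow> g x = (\<Sum>k<Suc n. d k * (x - t) ^ k) + (x - t) ^ Suc n * R x"
    using Taylor_Peano[OF g] at tb by (metis greaterThanLessThan_iff zero_less_Suc)
  define P where "P x = (\<Sum>k<Suc n. d k * (x - t) ^ k)" for x
  define w where "w x = inverse ((x - t) ^ Suc n)" for x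
  define w' where "w' x = - (real (Suc n) * (x - t) ^ n * (w x * w x))" for x
  have gR': "g x * w x - P x * w x = R x" if "x \<in> {a<..<b} - {t}" for x
  proof -
    have "g x * w x - P x * w x = ((x - t) ^ Suc n * w x) * R x"
      using gR[of x] that by (simp add: P_def algebra_simps del: power_Suc sum.lessThan_Suc)
    also have "(x - t) ^ Suc n * w x = 1" using that by (simp add: w_def del: power_Suc)
    finally show ?thesis by simp
  qed
  note cg = Ck_on_continuous[OF g]
  \<comment> \<open>Away from \<open>t\<close>, \<open>R\<close> is \<open>g * w - P * w\<close>
    with \<open>w\<close> continuously differentiable. Hence it inherits integrability at an
    endpoint from \<open>g\<close>, although \<open>g\<close> may be unbounded there.\<close>
  have R_end: "R integrable_on {p..q}"
    if pq: "p \<le> q" "{p..q} \<subseteq> {a..b} - {t}" and gi: "g integrable_on {p<..<q}" for p q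
  proof -
    have sub: "{p<..<q} \<subseteq> {a<..<b} - {t}"
    proof
      fix x assume x: "x \<in> {p<..<q}"
      then have "p \<in> {a..b} - {t}" "q \<in> {a..b} - {t}" "x \<in> {a..b} - {t}"
        using pq(1) by (intro subsetD[OF pq(2)]; simp)+
      then show "x \<in> {a<..<b} - {t}" using x by auto
    qed
    have cw: "continuous_on {p..q} w" unfolding w_def using pq(2)
      by (intro continuous_intros) auto
    have "(\<lambda>x. g x * w x) integrable_on {p..q}"
    proof (rule integrable_on_mult_C1[OF _ pq(1)])
      show "g integrable_on {p..q}" using gi by (simp add: integrable_on_Icc_iff_Ioo)
      show "continuous_on {p<..<q} g" using cg sub by (auto intro: continuous_on_subset)
      show "(w has_real_derivative w' x) (at x)" if "x \<in> {p..q}" for x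
        unfolding w'_def w_def using that pq(2)
        by (auto intro!: derivative_eq_intros simp del: power_Suc)
      show "continuous_on {p..q} w'"
        unfolding w'_def by (intro continuous_intros cw)
    qed
    moreover have "(\<lambda>x. P x * w x) integrable_on {p..q}"
      unfolding P_def by (intro integrable_continuous_interval continuous_intros cw)
    \<comment> \<open>The identity \<open>gR'\<close> holds only inside (a, b), so the functions are
      compared on the open interval; adding the endpoints does not affect integrability.\<close>
    ultimately have "(\<lambda>x. g x * w x - P x * w x) integrable_on {p<..<q}"
      unfolding integrable_on_Icc_iff_Ioo[symmetric] by (rule integrable_diff)
    then have "R integrable_on {p<..<q}"
      by (rule integrable_eq) (use gR' sub in blast)
    then show ?thesis by (simp add: integrable_on_Icc_iff_Ioo)
  qed
  \<comment> \<open>The widths are chosen below the distance to \<open>t\<close>, so that both end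
    pieces avoid the singularity; on the middle piece \<open>R\<close> is continuous, even across
    \<open>t\<close>.\<close>
  have "\<forall>\<^sub>F \<delta> in at_right 0. g integrable_on {a<..<a + \<delta>} \<and> \<delta> \<in> {0<..<t - a}"
    using ga eventually_at_right_real[of 0 "t - a"] at by (intro eventually_conj) auto
  then obtain \<delta> where \<delta>: "g integrable_on {a<..<a + \<delta>}" "0 < \<delta>" "\<delta> < t - a"
    using eventually_happens'[OF trivial_limit_at_right_real] by fastforce
  have "\<forall>\<^sub>F \<delta> in at_right 0. g integrable_on {b - \<delta><..<b} \<and> \<delta> \<in> {0<..<b - t}"
    using gb eventually_at_right_real[of 0 "b - t"] tb by (intro eventually_conj) auto
  then obtain \<gamma> where \<gamma>: "g integrable_on {b - \<gamma><..<b}" "0 < \<gamma>" "\<gamma> < b - t"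
    using eventually_happens'[OF trivial_limit_at_right_real] by fastforce
  have "R integrable_on {a..a + \<delta>}" using \<delta> at tb by (intro R_end) auto
  moreover have "R integrable_on {a + \<delta>..b - \<gamma>}" using \<delta> \<gamma>
    by (intro integrable_continuous_interval continuous_on_subset[OF cR]) auto
  ultimately have "R integrable_on {a..b - \<gamma>}"
    using \<delta> \<gamma> Henstock_Kurzweil_Integration.integrable_combine[of a "a + \<delta>" "b - \<gamma>" R] by simp
  moreover have "R integrable_on {b - \<gamma>..b}" using \<gamma> at tb by (intro R_end) auto
  ultimately have iR: "R integrable_on {a..b}"
    using \<delta> \<gamma> Henstock_Kurzweil_Integration.integrable_combine[of a "b - \<gamma>" b R] by simp
  define H where "H x = integral {a..x} R" for x
  have dH: "(H has_real_derivative R x) (at x)" if "x \<in> {a<..<b}" for x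
    unfolding H_def using cR that
    by (intro integral_has_real_derivative_isCont[OF iR]) (simp_all add: continuous_on_eq_continuous_at)
  \<comment> \<open>From integrating \<open>d k\<close> times (x - t)^(k-n-1), whose antiderivative
    has exponent -(n-k); \<open>n - k\<close> is nonzero for \<open>k < n\<close>.\<close>
  define C where "C k = - d k / real (n - k)" for k
  show ?thesis
  proof (intro exI conjI ballI)
    show "continuous_on {a..b} H"
      unfolding H_def by (rule indefinite_integral_continuous_1[OF iR])
    fix x assume x: "x \<in> {a<..<b} - {t}"
    define y where "y = x - t"
    have y: "y \<noteq> 0" using x by (simp add: y_def)
    have pow: "((\<lambda>x. C k / (x - t) ^ (n - k)) has_real_derivative d k * y ^ k / y ^ Suc n) (at x)"
      if k: "k < n" for k
    proof -
      obtain j where j: "n - k = Suc j" using k by (cases "n - k") auto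
      then have n: "n = k + Suc j" using k by simp
      have "((\<lambda>x. (x - t) ^ Suc j) has_real_derivative real (Suc j) * y ^ j) (at x)"
        unfolding y_def by (auto intro!: derivative_eq_intros simp del: power_Suc)
      from DERIV_divide[OF DERIV_const[of "C k"] this]
      have "((\<lambda>x. C k / (x - t) ^ Suc j) has_real_derivative
          - (C k * (real (Suc j) * y ^ j)) / (y ^ Suc j * y ^ Suc j)) (at x)"
        using y by (simp add: y_def[symmetric] del: power_Suc)
      moreover have "- (C k * (real (Suc j) * y ^ j)) / (y ^ Suc j * y ^ Suc j) = d k * y ^ k / y ^ Suc n"
      proof -
        have "C k * real (Suc j) = - d k" by (simp add: C_def j del: of_nat_Suc)
        then have "- (C k * (real (Suc j) * y ^ j)) = d k * y ^ j" by (simp add: mult.assoc[symmetric])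
        then show ?thesis unfolding n using y by (simp add: field_simps power_add)
      qed
      ultimately show ?thesis by (simp add: j)
    qed
    \<comment> \<open>The logarithm of the square serves both sides of \<open>t\<close>; the factor
      1/2 offsets its derivative 2/(x - t).\<close>
    have log: "((\<lambda>x. d n / 2 * ln ((x - t)\<^sup>2)) has_real_derivative d n * y ^ n / y ^ Suc n) (at x)"
    proof -
      have "y\<^sup>2 > 0" using y by simp
      then have "((\<lambda>x. d n / 2 * ln ((x - t)\<^sup>2)) has_real_derivative d n / 2 * (2 * y / y\<^sup>2)) (at x)"
        unfolding y_def by (auto intro!: derivative_eq_intros)
      moreover have "d n / 2 * (2 * y / y\<^sup>2) = d n * y ^ n / y ^ Suc n"
        using y by (simp add: power2_eq_square)
      ultimately show ?thesis by simp
    qed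
    have "((\<lambda>x. (\<Sum>k<n. C k / (x - t) ^ (n - k)) + d n / 2 * ln ((x - t)\<^sup>2) + H x)
        has_real_derivative (\<Sum>k<n. d k * y ^ k / y ^ Suc n) + d n * y ^ n / y ^ Suc n + R x) (at x)"
      using x by (intro DERIV_add DERIV_sum pow log dH) auto
    moreover have "(\<Sum>k<n. d k * y ^ k / y ^ Suc n) + d n * y ^ n / y ^ Suc n + R x = f x"
      using x y f[OF x] gR[of x]
      by (simp add: y_def[symmetric] add_divide_distrib sum_divide_distrib del: power_Suc)
    ultimately show "((\<lambda>x. (\<Sum>k<n. C k / (x - t) ^ (n - k)) + d n / 2 * ln ((x - t)\<^sup>2) + H x)
        has_real_derivative f x) (at x)" by simp
  qed
qed

section \<open>The finite part under a change of variable\<close>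

lemma Ck_on_Suc_deriv:
  assumes "Ck_on (Suc n) f {a..b}" and x: "x \<in> {a<..<b}"
  shows "(f has_real_derivative deriv f x) (at x)"
proof -
  obtain D where D0: "\<And>x. x \<in> {a..b} \<Longrightarrow> D 0 x = f x"
    and D: "\<And>x. x \<in> {a..b} \<Longrightarrow> (D 0 has_real_derivative D (Suc 0) x) (at x within {a..b})"
    using assms(1) unfolding Ck_on_def by (metis zero_less_Suc)
  have "(D 0 has_real_derivative D (Suc 0) x) (at x)"
    using D[of x] x by (simp add: at_within_Icc_at)
  moreover have "\<forall>\<^sub>F y in nhds x. D 0 y = f y"
    using x by (intro eventually_nhds_in_open[THEN eventually_mono, of "{a<..<b}"]) (auto simp: D0)
  ultimately have "(f has_real_derivative D (Suc 0) x) (at x)"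
    using DERIV_cong_ev by blast
  then show ?thesis by (simp add: DERIV_imp_deriv)
qed

text \<open>Division by \<open>s\<close> costs one order of the Taylor formula, so C^(n+1) gives
  order \<open>n\<close>, exactly what a pole of order at most \<open>n\<close> requires.\<close>

lemma expands_difference_quotient:
  fixes \<psi> :: "real \<Rightarrow> real"
  assumes "Ck_on (Suc n) \<psi> {\<alpha><..<\<beta>}" and \<tau>: "\<tau> \<in> {\<alpha><..<\<beta>}"
  shows "expands n (\<lambda>s. (\<psi> (\<tau> + s) - \<psi> \<tau>) / s)"
proof -
  obtain e R where cR: "continuous_on {\<alpha><..<\<beta>} R"
    and e: "\<And>x. x \<in> {\<alpha><..<\<beta>} \<Longrightarrow> \<psi> x = (\<Sum>k<Suc n. e k * (x - \<tau>) ^ k) + (x - \<tau>) ^ Suc n * R x"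
    using Taylor_Peano[OF assms] by blast
  have e0: "e 0 = \<psi> \<tau>"
    using e[OF \<tau>] by (simp add: sum.lessThan_Suc_shift del: sum.lessThan_Suc)
  have "isCont R \<tau>" using cR \<tau> by (simp add: continuous_on_eq_continuous_at)
  then have lim: "((\<lambda>s. R (\<tau> + s)) \<longlongrightarrow> R \<tau>) (at 0)" by (simp add: isCont_iff)
  have "\<forall>\<^sub>F s in at 0. s \<in> {\<alpha> - \<tau><..<\<beta> - \<tau>} - {0}"
    using \<tau> by (intro eventually_at_in_open) auto
  then have "\<forall>\<^sub>F s in at 0. (\<psi> (\<tau> + s) - \<psi> \<tau>) / s = (\<Sum>k<n. e (Suc k) * s ^ k) + s ^ n * R (\<tau> + s)"
  proof eventually_elim
    case (elim s)
    then have "\<psi> (\<tau> + s) - \<psi> \<tau> = s * ((\<Sum>k<n. e (Suc k) * s ^ k) + s ^ n * R (\<tau> + s))"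
      by (subst e) (auto simp: sum.lessThan_Suc_shift e0 sum_distrib_left algebra_simps
          simp del: sum.lessThan_Suc)
    then show ?case using elim by simp
  qed
  then show ?thesis
    by (rule expands_cong) (rule expands_polynomial_remainder[OF lim])
qed

text \<open>The value \<open>G b - G a\<close> does not mention \<psi>, so the given transformation
  and the identity, both instances of this lemma, yield the same finite part.\<close>

lemma has_fp_integral_substitution:
  fixes f \<psi> H :: "real \<Rightarrow> real" and C :: "nat \<Rightarrow> real"
  assumes \<psi>: "Ck_on (Suc n) \<psi> {\<alpha>..\<beta>}" and pos: "\<And>\<xi>. \<xi> \<in> {\<alpha><..<\<beta>} \<Longrightarrow> deriv \<psi> \<xi> > 0"
    and ends: "\<psi> \<alpha> = a" "\<psi> \<beta> = b" and \<tau>: "\<tau> \<in> {\<alpha><..<\<beta>}" "\<psi> \<tau> = t"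
    and cH: "continuous_on {a..b} H"
    and G: "\<And>x. G x = (\<Sum>k<n. C k / (x - t) ^ (n - k)) + c * ln ((x - t)\<^sup>2) + H x"
    and dG: "\<And>x. x \<in> {a<..<b} - {t} \<Longrightarrow> (G has_real_derivative f x) (at x)"
  shows "has_fp_integral (\<lambda>\<xi>. f (\<psi> \<xi>) * deriv \<psi> \<xi>) \<alpha> \<beta> \<tau> (G b - G a)"
proof -
  note d\<psi> = Ck_on_Suc_deriv[OF \<psi>]
  note c\<psi> = Ck_on_continuous[OF \<psi>]
  have mono: "\<psi> x < \<psi> y" if "\<alpha> \<le> x" "x < y" "y \<le> \<beta>" for x y
  \<comment> \<open>The derivative is known to be positive only in the open interval; continuity
    carries strict monotonicity to the endpoints.\<close>
  proof (rule DERIV_pos_imp_increasing_open[OF that(2)])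
    show "\<exists>d. (\<psi> has_real_derivative d) (at z) \<and> d > 0" if "x < z" "z < y" for z
      using d\<psi>[of z] pos[of z] that \<open>\<alpha> \<le> x\<close> \<open>y \<le> \<beta>\<close> by auto
    show "continuous_on {x..y} \<psi>"
      using that by (intro continuous_on_subset[OF c\<psi>]) auto
  qed
  have ne: "\<psi> x \<noteq> t" if "x \<in> {\<alpha>..\<beta>} - {\<tau>}" for x
    using mono[of x \<tau>] mono[of \<tau> x] that \<tau> by (cases "x < \<tau>") auto
  have range: "\<psi> x \<in> {a..b}" if "x \<in> {\<alpha>..\<beta>}" for x
    using mono[of \<alpha> x] mono[of x \<beta>] that ends by (cases "x = \<alpha>"; cases "x = \<beta>") auto
  have range': "\<psi> x \<in> {a<..<b}" if "x \<in> {\<alpha><..<\<beta>}" for x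
    using mono[of \<alpha> x] mono[of x \<beta>] that ends by auto
  have cG: "continuous_on ({a..b} - {t}) G"
    unfolding G by (intro continuous_intros continuous_on_subset[OF cH]) auto
  have ftc: "((\<lambda>\<xi>. f (\<psi> \<xi>) * deriv \<psi> \<xi>) has_integral (G (\<psi> q) - G (\<psi> p))) {p..q}"
    if "p \<le> q" and pq: "{p..q} \<subseteq> {\<alpha>..\<beta>} - {\<tau>}" for p q
  proof (rule fundamental_theorem_of_calculus_interior[OF \<open>p \<le> q\<close>])
    show "continuous_on {p..q} (\<lambda>x. G (\<psi> x))"
    proof (rule continuous_on_compose2[OF cG])
      show "continuous_on {p..q} \<psi>" using pq by (intro continuous_on_subset[OF c\<psi>]) auto
      show "\<psi> ` {p..q} \<subseteq> {a..b} - {t}" using pq range ne by blast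
    qed
    fix x assume x: "x \<in> {p<..<q}"
    have "p \<in> {\<alpha>..\<beta>} - {\<tau>}" "q \<in> {\<alpha>..\<beta>} - {\<tau>}" "x \<in> {\<alpha>..\<beta>} - {\<tau>}"
      using x by (intro subsetD[OF pq]; simp)+
    then have x': "x \<in> {\<alpha><..<\<beta>}" "\<psi> x \<noteq> t" using x ne by auto
    then have "\<psi> x \<in> {a<..<b} - {t}" using range' by auto
    from DERIV_chain2[OF dG[OF this] d\<psi>[OF x'(1)]]
    show "((\<lambda>x. G (\<psi> x)) has_vector_derivative f (\<psi> x) * deriv \<psi> x) (at x)"
      by (simp add: has_real_derivative_iff_has_vector_derivative)
  qed
  \<comment> \<open>Near \<tau>, \<psi> - t is s times \<open>r s\<close>, where \<open>r\<close>
    tends to a positive limit and can be inverted. The value at \<open>s = 0\<close> is invisible to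
    the punctured filter \<open>at 0\<close>.\<close>
  define r where "r s = (\<psi> (\<tau> + s) - t) / s" for s
  define p where "p = deriv \<psi> \<tau>"
  have p: "p > 0" using pos \<tau> by (simp add: p_def)
  have r_lim: "(r \<longlongrightarrow> p) (at 0)"
    using d\<psi>[OF \<tau>(1)] \<tau>(2) unfolding r_def p_def DERIV_def by simp
  have open_sub: "{\<alpha><..<\<beta>} \<subseteq> {\<alpha>..\<beta>}" by auto
  have r_exp: "expands n r"
    using expands_difference_quotient[OF Ck_on_subset[OF \<psi> open_sub] \<tau>(1)]
    unfolding r_def \<tau>(2) .
  \<comment> \<open>This is \<open>s ^ n\<close> times the pole part of G(\<psi>(\<tau> + s)), which
    follows from n = (n - k) + k.\<close>
  define U where "U s = (\<Sum>k<n. C k * (inverse (r s) ^ (n - k) * s ^ k))" for s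
  have "expands n U" unfolding U_def
    using p by (intro expands_sum expands_mult expands_const expands_power expands_id
        expands_inverse[OF r_exp r_lim]) auto
  then obtain d where d: "((\<lambda>\<epsilon>. U (- \<epsilon>) / (- \<epsilon>) ^ n - U \<epsilon> / \<epsilon> ^ n - (\<Sum>k=1..n. d k / \<epsilon> ^ k)) \<longlongrightarrow> 0)
    (at_right 0)" using expands_odd_part by blast
  \<comment> \<open>What remains with a limit once ln((s r)^2) is split into ln(s^2) +
    ln(r^2).\<close>
  define V where "V s = c * ln ((r s)\<^sup>2) + H (\<psi> (\<tau> + s))" for s
  have "isCont H t" using cH range'[OF \<tau>(1)] \<tau>(2) by (intro continuous_on_interior[OF cH]) auto
  moreover have "isCont \<psi> \<tau>" using d\<psi>[OF \<tau>(1)] by (rule DERIV_isCont)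
  then have "((\<lambda>s. \<psi> (\<tau> + s)) \<longlongrightarrow> t) (at 0)" using \<tau>(2) by (simp add: isCont_iff)
  ultimately have "((\<lambda>s. H (\<psi> (\<tau> + s))) \<longlongrightarrow> H t) (at 0)"
    by (rule isCont_tendsto_compose)
  then have "(V \<longlongrightarrow> c * ln (p\<^sup>2) + H t) (at 0)"
    unfolding V_def using p by (intro tendsto_add tendsto_mult tendsto_const tendsto_ln tendsto_power r_lim) auto
  note V = tendsto_odd_part[OF this]
  have GUV: "G (\<psi> (\<tau> + s)) = U s / s ^ n + c * ln (s\<^sup>2) + V s" if "s \<noteq> 0" "r s \<noteq> 0" for s
  proof -
    have h: "\<psi> (\<tau> + s) - t = s * r s" using that by (simp add: r_def)
    have "C k / (s * r s) ^ (n - k) = C k * (inverse (r s) ^ (n - k) * s ^ k) / s ^ n" if "k < n" for k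
    proof -
      have "s ^ n = s ^ (n - k) * s ^ k" using that by (simp flip: power_add)
      then show ?thesis using \<open>s \<noteq> 0\<close> \<open>r s \<noteq> 0\<close> by (simp add: power_mult_distrib field_simps)
    qed
    then have "(\<Sum>k<n. C k / (s * r s) ^ (n - k)) = U s / s ^ n"
      by (simp add: U_def sum_divide_distrib)
    moreover have "ln ((s * r s)\<^sup>2) = ln (s\<^sup>2) + ln ((r s)\<^sup>2)"
      using that by (simp add: power_mult_distrib ln_mult)
    ultimately show ?thesis by (simp add: G h V_def algebra_simps)
  qed
  have "\<forall>\<^sub>F s in at 0. r s \<noteq> 0"
    using p by (intro tendsto_imp_eventually_ne[OF r_lim]) auto
  note rne = eventually_at_0_symmetric[OF this]
  have "\<forall>\<^sub>F \<epsilon> in at_right 0. \<epsilon> \<in> {0<..<min (\<tau> - \<alpha>) (\<beta> - \<tau>)}"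
    using \<tau> by (intro eventually_at_right_real) auto
  \<comment> \<open>The coefficient of \<open>ln \<epsilon>\<close> is 0: the values at -\<epsilon>
    and \<epsilon> contain the same term \<open>c * ln (\<epsilon>\<^sup>2)\<close>, which cancels
    in the difference.\<close>
  with rne have ev: "\<forall>\<^sub>F \<epsilon> in at_right 0.
      excised_integral (\<lambda>\<xi>. f (\<psi> \<xi>) * deriv \<psi> \<xi>) \<alpha> \<beta> \<tau> \<epsilon> - ((\<Sum>k=1..n. d k / \<epsilon> ^ k) + 0 * ln \<epsilon>)
      = (U (- \<epsilon>) / (- \<epsilon>) ^ n - U \<epsilon> / \<epsilon> ^ n - (\<Sum>k=1..n. d k / \<epsilon> ^ k)) + (V (- \<epsilon>) - V \<epsilon>) + (G b - G a)"
  proof eventually_elim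
    case (elim \<epsilon>)
    have "excised_integral (\<lambda>\<xi>. f (\<psi> \<xi>) * deriv \<psi> \<xi>) \<alpha> \<beta> \<tau> \<epsilon>
        = (G (\<psi> (\<tau> - \<epsilon>)) - G a) + (G b - G (\<psi> (\<tau> + \<epsilon>)))"
      unfolding excised_integral_def using elim \<tau> ends
      by (intro arg_cong2[where f = "(+)"] integral_unique)
         (auto simp flip: ends intro!: ftc)
    moreover have "G (\<psi> (\<tau> + \<epsilon>)) = U \<epsilon> / \<epsilon> ^ n + c * ln (\<epsilon>\<^sup>2) + V \<epsilon>"
      using elim by (intro GUV) auto
    moreover have "G (\<psi> (\<tau> - \<epsilon>)) = U (- \<epsilon>) / (- \<epsilon>) ^ n + c * ln (\<epsilon>\<^sup>2) + V (- \<epsilon>)"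
      using GUV[of "- \<epsilon>"] elim by simp
    ultimately show ?case by simp
  qed
  have "((\<lambda>\<epsilon>. excised_integral (\<lambda>\<xi>. f (\<psi> \<xi>) * deriv \<psi> \<xi>) \<alpha> \<beta> \<tau> \<epsilon>
      - ((\<Sum>k=1..n. d k / \<epsilon> ^ k) + 0 * ln \<epsilon>)) \<longlongrightarrow> 0 + 0 + (G b - G a)) (at_right 0)"
    unfolding tendsto_cong[OF ev] by (intro tendsto_add d V tendsto_const)
  then have lim: "((\<lambda>\<epsilon>. excised_integral (\<lambda>\<xi>. f (\<psi> \<xi>) * deriv \<psi> \<xi>) \<alpha> \<beta> \<tau> \<epsilon>
      - ((\<Sum>k=1..n. d k / \<epsilon> ^ k) + 0 * ln \<epsilon>)) \<longlongrightarrow> G b - G a) (at_right 0)"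
    by (simp only: add_0_left)
  have "(\<lambda>\<xi>. f (\<psi> \<xi>) * deriv \<psi> \<xi>) integrable_on {p..q}"
    if "{p..q} \<subseteq> {\<alpha>..\<beta>} - {\<tau>}" for p q
  proof (cases "p \<le> q")
    case True
    then show ?thesis using has_integral_integrable[OF ftc[OF True that]] by simp
  next
    case False
    then show ?thesis by (simp add: integrable_on_empty)
  qed
  then show ?thesis unfolding has_fp_integral_def using \<tau>(1) lim
    by (intro conjI) (auto simp only: greaterThanLessThan_iff)
qed

section \<open>The identity as a transformation, and the conclusion\<close>

lemma Ck_on_ident: "Ck_on k (\<lambda>x. x) S"
  unfolding Ck_on_def
proof (intro exI[of _ "\<lambda>i x. if i = 0 then x else if i = 1 then 1 else 0"] conjI allI impI ballI)
  fix i :: nat and x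
  show "((\<lambda>x::real. if i = 0 then x else if i = 1 then 1 else 0) has_real_derivative
      (if Suc i = 0 then x else if Suc i = 1 then 1 else 0)) (at x within S)"
    by (cases "i = 0"; cases "i = 1") auto
  show "continuous_on S (\<lambda>x. if i = 0 then x else if i = 1 then 1 else 0)"
    by (cases "i = 0"; cases "i = 1") auto
qed auto

theorem theorem3p1:
  fixes m :: nat and a b t \<alpha> \<beta> :: real and f g \<psi> :: "real \<Rightarrow> real"
  assumes "m > 0" and "a < t" and "t < b"
    and "\<And>x. x \<in> {a<..<b} - {t} \<Longrightarrow> f x = g x / (x - t) ^ m"
    and "Ck_on m g {a<..<b}"
    and "\<forall>\<^sub>F \<delta> in at_right 0. g integrable_on {a<..<a + \<delta>}"
    and "\<forall>\<^sub>F \<delta> in at_right 0. g integrable_on {b - \<delta><..<b}"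
    and "\<alpha> < \<beta>"
    and "\<psi> \<in> {\<alpha>..\<beta>} \<rightarrow> {a..b}" and "\<psi> \<alpha> = a" and "\<psi> \<beta> = b"
    and "Ck_on m \<psi> {\<alpha>..\<beta>}"
    and "\<And>\<xi>. \<xi> \<in> {\<alpha><..<\<beta>} \<Longrightarrow> deriv \<psi> \<xi> > 0"
  shows "fp_integrable f a b t \<and>
    (\<exists>!\<tau>. \<tau> \<in> {\<alpha><..<\<beta>} \<and> \<psi> \<tau> = t) \<and>
    (\<forall>\<tau>\<in>{\<alpha><..<\<beta>}. \<psi> \<tau> = t \<longrightarrow>
       fp_integrable (\<lambda>\<xi>. f (\<psi> \<xi>) * deriv \<psi> \<xi>) \<alpha> \<beta> \<tau> \<and>
       fp_integral (\<lambda>\<xi>. f (\<psi> \<xi>) * deriv \<psi> \<xi>) \<alpha> \<beta> \<tau> = fp_integral f a b t)"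
proof -
  obtain n where n: "m = Suc n" using \<open>m > 0\<close> by (cases m) auto
  note \<psi> = assms(12)[unfolded n] and pos = assms(13)
  obtain C :: "nat \<Rightarrow> real" and c H where cH: "continuous_on {a..b} H"
    and dG: "\<And>x. x \<in> {a<..<b} - {t} \<Longrightarrow>
      ((\<lambda>x. (\<Sum>k<n. C k / (x - t) ^ (n - k)) + c * ln ((x - t)\<^sup>2) + H x) has_real_derivative f x) (at x)"
    using fp_antiderivative[OF assms(2,3) assms(4,5)[unfolded n] assms(6,7)] by blast
  define G where "G x = (\<Sum>k<n. C k / (x - t) ^ (n - k)) + c * ln ((x - t)\<^sup>2) + H x" for x
  have dG': "(G has_real_derivative f x) (at x)" if "x \<in> {a<..<b} - {t}" for x
    using dG[OF that] unfolding G_def .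
  \<comment> \<open>The identity on \<open>{a..b}\<close> has derivative 1, so the substituted
    integrand is \<open>f\<close> itself.\<close>
  have fp: "has_fp_integral f a b t (G b - G a)"
    using has_fp_integral_substitution[OF Ck_on_ident _ refl refl _ refl cH G_def dG'] assms(2,3)
    by simp
  have fp\<psi>: "has_fp_integral (\<lambda>\<xi>. f (\<psi> \<xi>) * deriv \<psi> \<xi>) \<alpha> \<beta> \<tau> (G b - G a)"
    if "\<tau> \<in> {\<alpha><..<\<beta>}" "\<psi> \<tau> = t" for \<tau>
    by (rule has_fp_integral_substitution[OF \<psi> pos assms(10,11) that cH G_def dG'])
  have cont: "continuous_on {\<alpha>..\<beta>} \<psi>" using \<psi> by (rule Ck_on_continuous)
  obtain \<tau> where "\<alpha> \<le> \<tau>" "\<tau> \<le> \<beta>" "\<psi> \<tau> = t"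
    using IVT'[of \<psi> \<alpha> t \<beta>] cont assms(2,3,8,10,11) by auto
  \<comment> \<open>The endpoints are excluded because \<psi> takes the values \<open>a\<close> and
    \<open>b\<close> there, while a < t < b.\<close>
  then have \<tau>: "\<tau> \<in> {\<alpha><..<\<beta>}" "\<psi> \<tau> = t"
    using assms(2,3,10,11) by (auto simp: less_le)
  have mono: "\<psi> x < \<psi> y" if "x \<in> {\<alpha><..<\<beta>}" "y \<in> {\<alpha><..<\<beta>}" "x < y" for x y
  proof (rule DERIV_pos_imp_increasing[OF that(3)])
    show "\<exists>d. (\<psi> has_real_derivative d) (at z) \<and> d > 0" if "x \<le> z" "z \<le> y" for z
      using Ck_on_Suc_deriv[OF \<psi>, of z] pos[of z] that \<open>x \<in> _\<close> \<open>y \<in> _\<close> by auto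
  qed
  have "\<exists>!\<tau>. \<tau> \<in> {\<alpha><..<\<beta>} \<and> \<psi> \<tau> = t"
    using \<tau> mono by (metis less_irrefl linorder_neqE)
  moreover have "fp_integrable f a b t" using fp by (auto simp: fp_integrable_def)
  moreover have "fp_integrable (\<lambda>\<xi>. f (\<psi> \<xi>) * deriv \<psi> \<xi>) \<alpha> \<beta> \<sigma> \<and>
      fp_integral (\<lambda>\<xi>. f (\<psi> \<xi>) * deriv \<psi> \<xi>) \<alpha> \<beta> \<sigma> = fp_integral f a b t"
    if "\<sigma> \<in> {\<alpha><..<\<beta>}" "\<psi> \<sigma> = t" for \<sigma>
    unfolding fp_integral_eqI[OF fp] fp_integral_eqI[OF fp\<psi>[OF that]] fp_integrable_def
    using fp\<psi>[OF that] by auto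
  ultimately show ?thesis by simp
qed

end
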